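(* Let $X$ be a topological space, $n\in\mathbb{N}$ (a positive integer), and let $f\in\mathcal{C}(X)$ be such that $E(f)$ is non-empty and invariant under $f$. If $f=g^n$ for some $g\in\mathcal{C}(X)$, then $E(f)$ is invariant under $g$ and the induced maps satisfy $\sigma_{f,E(f)}=\sigma_{g,E(f)}^{\,n}$. In other words, if $\sigma_{f,E(f)}:\Lambda\to\Lambda$ has no $n$-th root (i.e. there is no map $\tau:\Lambda\to\Lambda$ with $\tau^n=\sigma_{f,E(f)}$), where $\Lambda$ indexes the path components of $E(f)$, then $f$ has no continuous $n$-th root on $X$.
   Context: $\mathcal{C}(X)$ is the set of all continuous self-maps of $X$. For a self-map $g$, $g^n$ denotes the $n$-fold composition of $g$ with itself; a continuous $n$-th root of $f$ is a $g\in\mathcal{C}(X)$ with $g^n=f$. For $f\in\mathcal{C}(X)$, $R(f)$ is the range of $f$, $F(f)=\{x\in X: f(x)=x\}$ is its set of fixed points, and $E(f)=R(f)\setminus F(f)$. A subset $Y\subseteq X$ is invariant under $f$ if $f(Y)\subseteq Y$. If $Y$ is a non-empty subset of $X$ invariant under $f\in\mathcal{C}(X)$ and $Y=\bigcup_{\alpha\in\Lambda}Y_\alpha$ is its decomposition into (distinct) path components, then the map induced by $f$ and $Y$ is the unique map $\sigma_{f,Y}:\Lambda\to\Lambda$ such that $\sigma_{f,Y}(\alpha)=\beta$ if and only if $f(x)\in Y_\beta$ whenever $x\in Y_\alpha$. *)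

theory Defs
  imports "HOL-Analysis.Analysis"
begin

text \<open>
  Self-maps of a space \<open>X\<close> are HOL functions of which only the values on \<open>topspace X\<close> matter;
  equality of self-maps is accordingly equality on \<open>topspace X\<close>.
\<close>

definition range_of :: "'a topology \<Rightarrow> ('a \<Rightarrow> 'a) \<Rightarrow> 'a set"
  where "range_of X f = f ` topspace X"

definition fixed_points :: "'a topology \<Rightarrow> ('a \<Rightarrow> 'a) \<Rightarrow> 'a set"
  where "fixed_points X f = {x \<in> topspace X. f x = x}"

definition nonfixed_range :: "'a topology \<Rightarrow> ('a \<Rightarrow> 'a) \<Rightarrow> 'a set"
  where "nonfixed_range X f = range_of X f - fixed_points X f"

definition invariant_under :: "('a \<Rightarrow> 'a) \<Rightarrow> 'a set \<Rightarrow> bool"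
  where "invariant_under f Y \<longleftrightarrow> f ` Y \<subseteq> Y"

definition continuous_nth_root :: "'a topology \<Rightarrow> nat \<Rightarrow> ('a \<Rightarrow> 'a) \<Rightarrow> ('a \<Rightarrow> 'a) \<Rightarrow> bool"
  where "continuous_nth_root X n f g \<longleftrightarrow>
    continuous_map X X g \<and> (\<forall>x\<in>topspace X. f x = (g ^^ n) x)"

definition path_decomposition :: "'a topology \<Rightarrow> 'a set \<Rightarrow> 'i set \<Rightarrow> ('i \<Rightarrow> 'a set) \<Rightarrow> bool"
  where "path_decomposition X Y \<Lambda> P \<longleftrightarrow>
    bij_betw P \<Lambda> (path_components_of (subtopology X Y))"

text \<open>
  The map on \<open>\<Lambda>\<close> induced by \<open>f\<close> and \<open>Y = (\<Union>\<alpha>\<in>\<Lambda>. P \<alpha>)\<close>. Taking it in the extensional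
  function space makes it a unique HOL function; it exists by \<open>induced_map_ex1\<close> below whenever
  \<open>f\<close> is continuous and \<open>Y\<close> is invariant.
\<close>

definition is_induced_map ::
    "('a \<Rightarrow> 'a) \<Rightarrow> 'i set \<Rightarrow> ('i \<Rightarrow> 'a set) \<Rightarrow> ('i \<Rightarrow> 'i) \<Rightarrow> bool"
  where "is_induced_map f \<Lambda> P \<sigma> \<longleftrightarrow> \<sigma> \<in> \<Lambda> \<rightarrow>\<^sub>E \<Lambda> \<and>
    (\<forall>\<alpha>\<in>\<Lambda>. \<forall>\<beta>\<in>\<Lambda>. \<sigma> \<alpha> = \<beta> \<longleftrightarrow> (\<forall>x\<in>P \<alpha>. f x \<in> P \<beta>))"

definition induced_map :: "('a \<Rightarrow> 'a) \<Rightarrow> 'i set \<Rightarrow> ('i \<Rightarrow> 'a set) \<Rightarrow> 'i \<Rightarrow> 'i"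
  where "induced_map f \<Lambda> P = (THE \<sigma>. is_induced_map f \<Lambda> P \<sigma>)"

lemma induced_map_ex1:
  assumes f: "continuous_map X X f" and Y: "Y \<subseteq> topspace X" "invariant_under f Y"
    and P: "path_decomposition X Y \<Lambda> P"
  shows "\<exists>!\<sigma>. is_induced_map f \<Lambda> P \<sigma>"
proof -
  let ?S = "subtopology X Y"
  have top: "topspace ?S = Y" using Y by auto
  have fS: "continuous_map ?S ?S f"
    using f Y by (auto simp: invariant_under_def continuous_map_in_subtopology
        intro: continuous_map_from_subtopology)
  have img: "P ` \<Lambda> = path_components_of ?S" and inj: "inj_on P \<Lambda>"
    using P by (auto simp: path_decomposition_def bij_betw_def)
  have *: "\<exists>!\<beta>. \<beta> \<in> \<Lambda> \<and> (\<forall>x\<in>P \<alpha>. f x \<in> P \<beta>)" if a: "\<alpha> \<in> \<Lambda>" for \<alpha>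
  proof -
    have C: "P \<alpha> \<in> path_components_of ?S" using a img by auto
    obtain x where x: "x \<in> P \<alpha>" using nonempty_path_components_of[OF C] by auto
    have xY: "x \<in> Y" using path_components_of_subset[OF C] x top by auto
    then have "f x \<in> \<Union> (path_components_of ?S)"
      using Y by (auto simp: Union_path_components_of invariant_under_def)
    then obtain \<beta> where b: "\<beta> \<in> \<Lambda>" "f x \<in> P \<beta>" using img by auto
    have D: "P \<beta> \<in> path_components_of ?S" using b img by auto
    have "path_connectedin ?S (f ` P \<alpha>)"
      by (rule path_connectedin_continuous_map_image[OF fS path_connectedin_path_components_of[OF C]])
    then have "f ` P \<alpha> \<subseteq> P \<beta>"
      by (rule path_components_of_maximal[OF D]) (use b x in \<open>auto simp: disjnt_iff\<close>)
    moreover have "\<gamma> = \<beta>" if "\<gamma> \<in> \<Lambda>" "f x \<in> P \<gamma>" for \<gamma>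
    proof -
      have "P \<gamma> \<in> path_components_of ?S" using that img by auto
      then have "P \<gamma> = P \<beta>"
        using pairwise_disjoint_path_components_of[of ?S] D that b
        by (auto simp: pairwise_def disjnt_iff)
      then show ?thesis using inj that b by (auto dest: inj_onD)
    qed
    ultimately show ?thesis using b x by blast
  qed
  define s where "s = restrict (\<lambda>\<alpha>. THE \<beta>. \<beta> \<in> \<Lambda> \<and> (\<forall>x\<in>P \<alpha>. f x \<in> P \<beta>)) \<Lambda>"
  have s: "s \<alpha> \<in> \<Lambda> \<and> (\<forall>x\<in>P \<alpha>. f x \<in> P (s \<alpha>))" if "\<alpha> \<in> \<Lambda>" for \<alpha>
    using theI'[OF *[OF that]] that by (simp add: s_def)
  show ?thesis
  proof (rule ex1I[of _ s])
    show "is_induced_map f \<Lambda> P s"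
      unfolding is_induced_map_def
    proof (intro conjI ballI)
      show "s \<in> \<Lambda> \<rightarrow>\<^sub>E \<Lambda>" using s by (auto simp: s_def PiE_def)
      show "s \<alpha> = \<beta> \<longleftrightarrow> (\<forall>x\<in>P \<alpha>. f x \<in> P \<beta>)" if "\<alpha> \<in> \<Lambda>" "\<beta> \<in> \<Lambda>" for \<alpha> \<beta>
        using s[OF that(1)] *[OF that(1)] that by blast
    qed
    show "t = s" if t: "is_induced_map f \<Lambda> P t" for t
    proof (rule extensionalityI[of _ \<Lambda>])
      show "t \<in> extensional \<Lambda>" "s \<in> extensional \<Lambda>"
        using t by (auto simp: is_induced_map_def PiE_def s_def)
      show "t \<alpha> = s \<alpha>" if "\<alpha> \<in> \<Lambda>" for \<alpha>
        using t s[OF that] that by (auto simp: is_induced_map_def)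
    qed
  qed
qed

end

(* A root g of f commutes with f and hence maps R(f) into itself. If x is in E(f) but g x is fixed by f, then
   g (f x) = f (g x) = g x, and applying g another n - 1 times gives f (f x) = f x, contradicting
   the invariance of E(f). *)
theory Submission
  imports Defs
begin

lemma is_induced_map_induced_map:
  assumes "continuous_map X X f" "Y \<subseteq> topspace X" "invariant_under f Y"
    and "path_decomposition X Y \<Lambda> P"
  shows "is_induced_map f \<Lambda> P (induced_map f \<Lambda> P)"
  unfolding induced_map_def by (rule theI'[OF induced_map_ex1[OF assms]])

text \<open>Induction on \<open>k\<close>: each further \<open>g\<close> carries the component
  reached so far into the one chosen by \<open>\<sigma>\<close>. This locates the image of
  \<open>P \<alpha>\<close> under an iterate without forming the induced map of that
  iterate.\<close>

lemma is_induced_map_funpow: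
  assumes \<sigma>: "is_induced_map g \<Lambda> P \<sigma>" and \<alpha>: "\<alpha> \<in> \<Lambda>"
  shows "(\<sigma> ^^ k) \<alpha> \<in> \<Lambda> \<and> (\<forall>x\<in>P \<alpha>. (g ^^ k) x \<in> P ((\<sigma> ^^ k) \<alpha>))"
proof (induction k)
  case 0
  then show ?case using \<alpha> by simp
next
  case (Suc k)
  let ?\<beta> = "(\<sigma> ^^ k) \<alpha>"
  have "\<sigma> ?\<beta> \<in> \<Lambda>" using \<sigma> Suc by (auto simp: is_induced_map_def)
  \<comment> \<open>The defining equivalence is instantiated at the target
    \<open>\<sigma> ?\<beta>\<close> itself, where its left side is trivially true; this requires
    \<open>\<sigma> ?\<beta> \<in> \<Lambda>\<close> first.\<close>
  moreover from this have "\<forall>y\<in>P ?\<beta>. g y \<in> P (\<sigma> ?\<beta>)"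
    using \<sigma> Suc unfolding is_induced_map_def by blast
  ultimately show ?case using Suc by simp
qed

lemma nonfixed_range_subset_topspace:
  assumes "continuous_map X X f"
  shows "nonfixed_range X f \<subseteq> topspace X"
  using continuous_map_image_subset_topspace[OF assms]
  by (auto simp: nonfixed_range_def range_of_def)

text \<open>Both sides equal \<open>g\<close> applied n + 1 times to \<open>x\<close>. Since
  \<open>f\<close> agrees with \<open>g ^^ n\<close> only on the space, \<open>g x\<close> must be
  known to lie there.\<close>

lemma continuous_nth_root_commute:
  assumes g: "continuous_nth_root X n f g" and x: "x \<in> topspace X"
  shows "f (g x) = g (f x)"
proof -
  have "g x \<in> topspace X"
    using g x by (auto simp: continuous_nth_root_def continuous_map_def)
  then show ?thesis using g x by (simp add: continuous_nth_root_def funpow_swap1)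
qed

lemma nonfixed_range_invariant_under_root:
  assumes n: "n > 0" and f: "continuous_map X X f"
    and inv: "invariant_under f (nonfixed_range X f)"
    and g: "continuous_nth_root X n f g"
  shows "invariant_under g (nonfixed_range X f)"
  unfolding invariant_under_def
proof (intro image_subsetI)
  fix x assume x: "x \<in> nonfixed_range X f"
  have g_top: "g y \<in> topspace X" if "y \<in> topspace X" for y
    using g that by (auto simp: continuous_nth_root_def continuous_map_def)
  have root: "f y = (g ^^ n) y" if "y \<in> topspace X" for y
    using g that by (simp add: continuous_nth_root_def)
  note comm = continuous_nth_root_commute[OF g]
  have xt: "x \<in> topspace X"
    using x nonfixed_range_subset_topspace[OF f] by blast
  \<comment> \<open>The contradiction below arises at \<open>f x\<close>: by invariance this point
    is again not fixed by \<open>f\<close>.\<close>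
  have fx: "f x \<in> nonfixed_range X f"
    using x inv by (auto simp: invariant_under_def)
  have fxt: "f x \<in> topspace X"
    using fx nonfixed_range_subset_topspace[OF f] by blast
  obtain y where y: "y \<in> topspace X" "x = f y"
    using x by (auto simp: nonfixed_range_def range_of_def)
  \<comment> \<open>Commuting turns a preimage \<open>y\<close> of \<open>x\<close> under
    \<open>f\<close> into the preimage \<open>g y\<close> of \<open>g x\<close>.\<close>
  have "g x = f (g y)" using comm[OF y(1)] y by simp
  then have "g x \<in> range_of X f"
    using g_top[OF y(1)] by (auto simp: range_of_def)
  moreover have "f (g x) \<noteq> g x"
  proof
    assume "f (g x) = g x"
    then have eq: "g (f x) = g x" using comm[OF xt] by simp
    \<comment> \<open>Positivity of \<open>n\<close> lets one innermost \<open>g\<close> be split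
      off from \<open>f\<close>, which is the single application that \<open>eq\<close> can
      rewrite.\<close>
    obtain m where m: "n = Suc m" using n by (cases n) auto
    have "f (f x) = (g ^^ m) (g (f x))"
      using root[OF fxt] by (simp add: m funpow_swap1)
    also have "\<dots> = (g ^^ m) (g x)" unfolding eq ..
    also have "\<dots> = f x" using root[OF xt] by (simp add: m funpow_swap1)
    finally show False
      using fx fxt by (simp add: nonfixed_range_def fixed_points_def)
  qed
  ultimately show "g x \<in> nonfixed_range X f"
    by (simp add: nonfixed_range_def fixed_points_def)
qed

text \<open>On \<open>P \<alpha>\<close> the map \<open>f\<close> is \<open>g ^^ n\<close>, so it
  sends this component into the one obtained by iterating the induced map of \<open>g\<close>. The
  argument works for any \<open>Y\<close> invariant under both maps.\<close>

lemma induced_map_nth_root: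
  assumes f: "continuous_map X X f" and g: "continuous_nth_root X n f g"
    and Y: "Y \<subseteq> topspace X" "invariant_under f Y" "invariant_under g Y"
    and P: "path_decomposition X Y \<Lambda> P" and \<alpha>: "\<alpha> \<in> \<Lambda>"
  shows "induced_map f \<Lambda> P \<alpha> = (induced_map g \<Lambda> P ^^ n) \<alpha>"
proof -
  have cg: "continuous_map X X g" using g by (simp add: continuous_nth_root_def)
  let ?\<beta> = "(induced_map g \<Lambda> P ^^ n) \<alpha>"
  have \<beta>: "?\<beta> \<in> \<Lambda>" "\<forall>x\<in>P \<alpha>. (g ^^ n) x \<in> P ?\<beta>"
    using is_induced_map_funpow[OF is_induced_map_induced_map[OF cg Y(1,3) P] \<alpha>] by auto
  have "P \<alpha> \<in> path_components_of (subtopology X Y)"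
    using P \<alpha> by (auto simp: path_decomposition_def bij_betw_def)
  then have "P \<alpha> \<subseteq> topspace X" using path_components_of_subset by fastforce
  then have "\<forall>x\<in>P \<alpha>. f x \<in> P ?\<beta>"
    using \<beta>(2) g by (auto simp: continuous_nth_root_def subset_iff)
  \<comment> \<open>Here the defining equivalence for \<open>f\<close> is read from right to left:
    mapping \<open>P \<alpha>\<close> into \<open>P ?\<beta>\<close> forces the value
    \<open>?\<beta>\<close>.\<close>
  then show ?thesis
    using is_induced_map_induced_map[OF f Y(1,2) P] \<alpha> \<beta>(1)
    by (simp add: is_induced_map_def)
qed

theorem theorem2p6:
  fixes X :: "'a topology" and n :: nat and f :: "'a \<Rightarrow> 'a"
    and \<Lambda> :: "'i set" and P :: "'i \<Rightarrow> 'a set"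
  assumes "n > 0"
    and "continuous_map X X f"
    and "nonfixed_range X f \<noteq> {}"
    and "invariant_under f (nonfixed_range X f)"
    and "path_decomposition X (nonfixed_range X f) \<Lambda> P"
  shows "(\<forall>g. continuous_nth_root X n f g \<longrightarrow>
            invariant_under g (nonfixed_range X f) \<and>
            (\<forall>\<alpha>\<in>\<Lambda>. induced_map f \<Lambda> P \<alpha> = (induced_map g \<Lambda> P ^^ n) \<alpha>))
       \<and> ((\<nexists>\<tau>. \<tau> \<in> \<Lambda> \<rightarrow> \<Lambda> \<and> (\<forall>\<alpha>\<in>\<Lambda>. (\<tau> ^^ n) \<alpha> = induced_map f \<Lambda> P \<alpha>)) \<longrightarrow>
            (\<nexists>g. continuous_nth_root X n f g))"
proof -
  let ?E = "nonfixed_range X f"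
  note sub = nonfixed_range_subset_topspace[OF assms(2)]
  have inv: "invariant_under g ?E" if "continuous_nth_root X n f g" for g
    using nonfixed_range_invariant_under_root assms(1,2,4) that by blast
  have pow: "induced_map f \<Lambda> P \<alpha> = (induced_map g \<Lambda> P ^^ n) \<alpha>"
    if "continuous_nth_root X n f g" "\<alpha> \<in> \<Lambda>" for g \<alpha>
    using induced_map_nth_root[OF assms(2) that(1) sub assms(4) inv[OF that(1)] assms(5) that(2)] .
  have mem: "induced_map g \<Lambda> P \<in> \<Lambda> \<rightarrow> \<Lambda>" if g: "continuous_nth_root X n f g" for g
  proof -
    have "continuous_map X X g" using g by (simp add: continuous_nth_root_def)
    from is_induced_map_induced_map[OF this sub inv[OF g] assms(5)]
    show ?thesis by (auto simp: is_induced_map_def)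
  qed
  show ?thesis
  proof (intro conjI impI allI ballI notI)
    fix g assume "continuous_nth_root X n f g"
    then show "invariant_under g ?E" by (rule inv)
  next
    fix g \<alpha> assume "continuous_nth_root X n f g" "\<alpha> \<in> \<Lambda>"
    then show "induced_map f \<Lambda> P \<alpha> = (induced_map g \<Lambda> P ^^ n) \<alpha>" by (rule pow)
  next
    assume no_root: "\<nexists>\<tau>. \<tau> \<in> \<Lambda> \<rightarrow> \<Lambda> \<and> (\<forall>\<alpha>\<in>\<Lambda>. (\<tau> ^^ n) \<alpha> = induced_map f \<Lambda> P \<alpha>)"
      and "\<exists>g. continuous_nth_root X n f g"
    then obtain g where g: "continuous_nth_root X n f g" by blast
    \<comment> \<open>The induced map of \<open>g\<close> is the forbidden witness for
      \<open>\<tau>\<close>; \<open>mem\<close> supplies that it is a self-map of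
      \<open>\<Lambda>\<close>.\<close>
    have "\<forall>\<alpha>\<in>\<Lambda>. (induced_map g \<Lambda> P ^^ n) \<alpha> = induced_map f \<Lambda> P \<alpha>"
      using pow[OF g] by simp
    then show False using no_root mem[OF g] by blast
  qed
qed

end
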